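(* Let $G$ be a connected graph of order $n\geq 5$, minimum degree $\delta\geq 2$ and vertex-connectivity $\kappa$. Let $H=K_{\delta-1}\vee (K_2\cup K_{n-\delta-1})$; its spectral radius $\rho(H)$ is the largest root of $$\lambda^3 - (n - 3)\lambda^2 - (2\delta-1)\lambda + 2\delta(n-\delta-1)-n+1=0.$$ If $\rho(G) \geq \rho(H)$, then $\kappa=\delta$, unless $G\cong H$.
   Context: All graphs are finite, simple and undirected. $\rho(G)$ denotes the spectral radius (largest eigenvalue) of the adjacency matrix of $G$. The vertex-connectivity $\kappa(G)$ of a connected non-complete graph is the minimum size of a vertex set whose removal disconnects $G$, and $\kappa(K_n)=n-1$. $K_r$ is the complete graph on $r$ vertices, $\cup$ is disjoint union and $G_1\vee G_2$ is the join (disjoint union plus all edges between $G_1$ and $G_2$). *)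

theory Defs
  imports
    "Graph_Theory.Graph_Theory"
    "Jordan_Normal_Form.Spectral_Radius"
begin

text \<open>
  A finite simple undirected graph is a \<^locale>\<open>pair_graph\<close>: a finite, loop-free digraph whose
  arcs are pairs of vertices, with a symmetric arc set; an edge \<open>uv\<close> is the pair of arcs
  \<open>(u,v)\<close>, \<open>(v,u)\<close>.  Hence the out-degree of a vertex is its degree.
\<close>

definition min_degree :: "'a pair_pre_digraph \<Rightarrow> nat" where
  "min_degree G = Min (out_degree (with_proj G) ` pverts G)"

text \<open>
  Since the library regards the graph without vertices as not connected, the separating sets
  are explicitly required to be proper subsets of the vertex set.
\<close>

definition vertex_connectivity :: "'a pair_pre_digraph \<Rightarrow> nat" where
  "vertex_connectivity G =
     (if K\<^bsub>card (pverts G)\<^esub> (with_proj G) then card (pverts G) - 1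
      else Min (card ` {S. S \<subset> pverts G \<and>
        \<not> Digraph_Component.connected (with_proj G \<restriction> (pverts G - S))}))"

definition adjacency_matrix :: "'a list \<Rightarrow> 'a pair_pre_digraph \<Rightarrow> real mat" where
  "adjacency_matrix vs G =
     mat (length vs) (length vs) (\<lambda>(i, j). if (vs ! i, vs ! j) \<in> parcs G then 1 else 0)"

text \<open>
  The vertices are listed in an arbitrary order; the spectrum does not depend on it
  (lemma \<open>spectrum_adjacency_matrix_order\<close> below).
\<close>

definition graph_spectral_radius :: "'a pair_pre_digraph \<Rightarrow> real" (\<open>\<rho>\<close>) where
  "\<rho> G = Max (spectrum (adjacency_matrix (SOME vs. distinct vs \<and> set vs = pverts G) G))"

definition complete_graph :: "nat \<Rightarrow> nat pair_pre_digraph" where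
  "complete_graph r = \<lparr> pverts = {..<r}, parcs = {(i, j). i < r \<and> j < r \<and> i \<noteq> j} \<rparr>"

definition disjoint_union ::
  "'a pair_pre_digraph \<Rightarrow> 'b pair_pre_digraph \<Rightarrow> ('a + 'b) pair_pre_digraph" where
  "disjoint_union G H =
     \<lparr> pverts = pverts G <+> pverts H,
       parcs = map_prod Inl Inl ` parcs G \<union> map_prod Inr Inr ` parcs H \<rparr>"

definition graph_join ::
  "'a pair_pre_digraph \<Rightarrow> 'b pair_pre_digraph \<Rightarrow> ('a + 'b) pair_pre_digraph" where
  "graph_join G H =
     \<lparr> pverts = pverts (disjoint_union G H),
       parcs = parcs (disjoint_union G H)
         \<union> (Inl ` pverts G) \<times> (Inr ` pverts H) \<union> (Inr ` pverts H) \<times> (Inl ` pverts G) \<rparr>"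

lemma spectrum_adjacency_matrix:
  assumes vs: "distinct vs"
  shows "spectrum (adjacency_matrix vs G) =
    {k. \<exists>f. (\<exists>v\<in>set vs. f v \<noteq> 0) \<and>
      (\<forall>u\<in>set vs. (\<Sum>v\<in>set vs. if (u, v) \<in> parcs G then f v else 0) = k * f u)}"
proof -
  let ?n = "length vs" and ?A = "adjacency_matrix vs G"
  have dim: "dim_row ?A = ?n" "dim_col ?A = ?n" by (simp_all add: adjacency_matrix_def)
  have sum: "(\<Sum>v\<in>set vs. g v) = (\<Sum>i<?n. g (vs ! i))" for g :: "'a \<Rightarrow> real"
    using sum.reindex_bij_betw[OF bij_betw_nth[OF vs refl refl], of g] by simp
  have mv: "(?A *\<^sub>v vec ?n (\<lambda>i. f (vs ! i))) $ i =
      (\<Sum>v\<in>set vs. if (vs ! i, v) \<in> parcs G then f v else 0)"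
    if "i < ?n" for f i
    unfolding sum using that
    by (auto simp: adjacency_matrix_def scalar_prod_def lessThan_atLeast0 intro!: sum.cong)
  have ev: "eigenvector ?A (vec ?n (\<lambda>i. f (vs ! i))) k \<longleftrightarrow>
      (\<exists>v\<in>set vs. f v \<noteq> 0) \<and>
      (\<forall>u\<in>set vs. (\<Sum>v\<in>set vs. if (u, v) \<in> parcs G then f v else 0) = k * f u)"
    (is "?L \<longleftrightarrow> ?R1 \<and> ?R2") for f k
  proof -
    have "vec ?n (\<lambda>i. f (vs ! i)) \<noteq> 0\<^sub>v ?n \<longleftrightarrow> ?R1"
      unfolding Bex_set list_ex_length by (auto simp: vec_eq_iff)
    moreover have "?A *\<^sub>v vec ?n (\<lambda>i. f (vs ! i)) = k \<cdot>\<^sub>v vec ?n (\<lambda>i. f (vs ! i)) \<longleftrightarrow> ?R2"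
      unfolding all_set_conv_all_nth
      by (auto simp: vec_eq_iff dim mv simp del: index_mult_mat_vec)
    ultimately show ?thesis unfolding eigenvector_def dim by simp
  qed
  have "\<exists>f. x = vec ?n (\<lambda>i. f (vs ! i))" if "x \<in> carrier_vec ?n" for x :: "real vec"
  proof
    show "x = vec ?n (\<lambda>i. (\<lambda>v. x $ the_inv_into {..<?n} ((!) vs) v) (vs ! i))"
      using that bij_betw_imp_inj_on[OF bij_betw_nth[OF vs refl refl]]
      by (intro eq_vecI) (auto simp: the_inv_into_f_f)
  qed
  then have "eigenvalue ?A k \<longleftrightarrow> (\<exists>f. eigenvector ?A (vec ?n (\<lambda>i. f (vs ! i))) k)" for k
    unfolding eigenvalue_def by (metis dim(1) eigenvector_def)
  then show ?thesis unfolding spectrum_def ev by (rule Collect_cong)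
qed

lemma spectrum_adjacency_matrix_order:
  assumes "distinct vs" "distinct ws" "set vs = set ws"
  shows "spectrum (adjacency_matrix vs G) = spectrum (adjacency_matrix ws G)"
  using assms by (simp add: spectrum_adjacency_matrix)

end

theory Submission
  imports Defs
begin

text \<open>
  If \<open>\<kappa> < \<delta>\<close>, a minimum cut \<open>S\<close> splits the remaining vertices into \<open>A\<close> and \<open>B\<close>, so that \<open>G\<close> is a
  spanning subgraph of \<open>K\<^sub>k \<or> (K\<^sub>a \<union> K\<^sub>b)\<close> with \<open>k = |S| \<le> \<delta> - 1\<close> and
  \<open>a, b \<ge> \<delta> - k + 1\<close>.  For \<open>t > max a b\<close> the vector equal to \<open>1\<close> on \<open>S\<close>, \<open>k/(t-a)\<close> on \<open>A\<close> and
  \<open>k/(t-b)\<close> on \<open>B\<close> satisfies the equation for the eigenvalue \<open>t - 1\<close> on \<open>A\<close> and \<open>B\<close>, and on \<open>S\<close> it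
  is a supersolution exactly when \<open>\<Phi>(k,a,b) = k (1/(t-a) + 1/(t-b) - 1/t) \<le> 1\<close>.  Take
  \<open>t = \<rho>(H) + 1\<close>, which is characterised by \<open>\<Phi>(\<delta>-1, 2, n-\<delta>-1) = 1\<close>.  Convexity of \<open>1/(t-x)\<close>
  and the monotonicity of \<open>(\<delta>-1-d)/(t-2-d)\<close> in \<open>d\<close> give \<open>\<Phi>(k,a,b) \<le> 1\<close> for all admissible
  \<open>(k,a,b)\<close>, hence \<open>\<rho>(G) \<le> \<rho>(H)\<close>.  Equality forces \<open>k = \<delta> - 1\<close>, \<open>{a,b} = {2, n-\<delta>-1}\<close>, and, since
  \<open>G\<close> is connected, equality in the eigenvalue equation everywhere, so no edge of the join is missing.
\<close>

section \<open>The spectral radius as largest adjacency eigenvalue\<close>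

text \<open>A complex eigenvector \<open>v\<close> for some \<open>k\<close> exists. By symmetry the
  Hermitian form \<open>Q\<close> of \<open>A\<close> at \<open>v\<close> is its own conjugate, and
  it is \<open>k\<close> times the nonzero real \<open>N\<close>; so \<open>k\<close> is real and a
  root of the real characteristic polynomial. Hence the \<open>Max\<close> defining \<rho> ranges
  over a nonempty set.\<close>

lemma symmetric_real_mat_eigenvalue_exists:
  fixes A :: "real mat"
  assumes A: "A \<in> carrier_mat n n" and "n > 0"
    and sym: "\<And>i j. i < n \<Longrightarrow> j < n \<Longrightarrow> A $$ (i, j) = A $$ (j, i)"
  shows "spectrum A \<noteq> {}"
proof -
  let ?C = "map_mat complex_of_real A"
  have C: "?C \<in> carrier_mat n n" using A by simp
  obtain k where k: "k \<in> spectrum ?C" using spectrum_non_empty[OF C \<open>n > 0\<close>] by auto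
  then obtain v where v: "v \<in> carrier_vec n" "v \<noteq> 0\<^sub>v n" "?C *\<^sub>v v = k \<cdot>\<^sub>v v"
    using A unfolding spectrum_def eigenvalue_def eigenvector_def by auto
  have Cv: "(\<Sum>j<n. complex_of_real (A $$ (i, j)) * v $ j) = k * v $ i" if "i < n" for i
  proof -
    have "(?C *\<^sub>v v) $ i = (\<Sum>j<n. complex_of_real (A $$ (i, j)) * v $ j)"
      using that A v(1) by (auto simp: scalar_prod_def lessThan_atLeast0 intro!: sum.cong)
    then show ?thesis using that v(1) unfolding v(3) by simp
  qed
  define N where "N = (\<Sum>i<n. (cmod (v $ i))\<^sup>2)"
  define Q where "Q = (\<Sum>i<n. \<Sum>j<n. cnj (v $ i) * (complex_of_real (A $$ (i, j)) * v $ j))"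
  have "Q = (\<Sum>i<n. cnj (v $ i) * (k * v $ i))"
    by (simp add: Q_def sum_distrib_left[symmetric] Cv)
  also have "\<dots> = k * complex_of_real N"
    unfolding N_def of_real_sum sum_distrib_left
    by (intro sum.cong) (auto simp only: complex_norm_square ac_simps of_real_power[symmetric])
  finally have QN: "Q = k * complex_of_real N" .
  have "cnj Q = (\<Sum>i<n. \<Sum>j<n. v $ i * (complex_of_real (A $$ (i, j)) * cnj (v $ j)))"
    by (simp add: Q_def)
  also have "\<dots> = (\<Sum>j<n. \<Sum>i<n. v $ i * (complex_of_real (A $$ (i, j)) * cnj (v $ j)))"
    by (rule sum.swap)
  also have "\<dots> = Q" unfolding Q_def by (intro sum.cong refl) (simp add: sym)
  finally have "cnj k * complex_of_real N = k * complex_of_real N" using QN by simp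
  moreover have "N \<noteq> 0"
  proof
    assume "N = 0"
    then have "v $ i = 0" if "i < n" for i
      using that unfolding N_def by (subst (asm) sum_nonneg_eq_0_iff) auto
    then show False using v(1,2) by (auto simp: vec_eq_iff)
  qed
  ultimately have "cnj k = k" by simp
  then obtain r where r: "k = complex_of_real r" using Reals_cnj_iff Reals_cases by metis
  have "poly (char_poly ?C) k = 0" using k spectrum_root_char_poly[OF C] by auto
  then have "poly (char_poly A) r = 0"
    using r by (simp add: of_real_hom.char_poly_hom[OF A])
  then show ?thesis using spectrum_root_char_poly[OF A] by auto
qed

lemma (in pair_graph) spectrum_eq_eigenfunctions:
  assumes vs: "distinct vs" "set vs = pverts G"
  shows "spectrum (adjacency_matrix vs G) =
    {k. \<exists>f. (\<exists>v\<in>pverts G. f v \<noteq> 0) \<and> (\<forall>u\<in>pverts G. sum f (parcs G `` {u}) = k * f u)}"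
proof -
  have "(\<Sum>v\<in>pverts G. if (u, v) \<in> parcs G then f v else 0) = sum f (parcs G `` {u})"
    for u and f :: "'a \<Rightarrow> real"
    using pair_finite_verts
    by (auto simp: sum.If_cases intro!: sum.cong dest: in_arcsD2)
  then show ?thesis using spectrum_adjacency_matrix[OF vs(1), of G] vs(2) by simp
qed

lemma (in pair_graph) parcs_sym: "(u, v) \<in> parcs G \<longleftrightarrow> (v, u) \<in> parcs G"
  using pair_sym_arcs by (auto simp: symmetric_def dest: symD)

text \<open>The spectrum is finite and, by symmetry of adjacency, nonempty, so its maximum is
  attained and is an upper bound. Later arguments use functions on vertices instead of
  matrices.\<close>

lemma (in pair_graph)
  assumes "pverts G \<noteq> {}"
  shows spectral_radius_eigenfunction:
      "\<exists>f. (\<exists>v\<in>pverts G. f v \<noteq> 0) \<and> (\<forall>u\<in>pverts G. sum f (parcs G `` {u}) = \<rho> G * f u)"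
    and eigenvalue_le_spectral_radius:
      "\<lbrakk>\<exists>v\<in>pverts G. f v \<noteq> 0; \<And>u. u \<in> pverts G \<Longrightarrow> sum f (parcs G `` {u}) = k * f u\<rbrakk>
        \<Longrightarrow> k \<le> \<rho> G"
proof -
  define vs where "vs = (SOME vs. distinct vs \<and> set vs = pverts G)"
  have "\<exists>vs. distinct vs \<and> set vs = pverts G"
    using finite_distinct_list[OF pair_finite_verts] by auto
  then have vs: "distinct vs" "set vs = pverts G" 
    unfolding vs_def by (rule someI2_ex, simp)+
  let ?A = "adjacency_matrix vs G"
  have A: "?A \<in> carrier_mat (length vs) (length vs)" by (simp add: adjacency_matrix_def)
  have fin: "finite (spectrum ?A)" using card_finite_spectrum(1)[OF A] .
  have "length vs > 0" using vs assms by auto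
  then have ne: "spectrum ?A \<noteq> {}"
    using parcs_sym by (intro symmetric_real_mat_eigenvalue_exists[OF A])
      (auto simp: adjacency_matrix_def)
  have rho: "\<rho> G = Max (spectrum ?A)" unfolding graph_spectral_radius_def vs_def ..
  show "\<exists>f. (\<exists>v\<in>pverts G. f v \<noteq> 0) \<and> (\<forall>u\<in>pverts G. sum f (parcs G `` {u}) = \<rho> G * f u)"
  proof -
    have "\<rho> G \<in> spectrum ?A" unfolding rho by (rule Max_in[OF fin ne])
    then show ?thesis by (simp add: spectrum_eq_eigenfunctions[OF vs])
  qed
  show "k \<le> \<rho> G" if "\<exists>v\<in>pverts G. f v \<noteq> 0"
    "\<And>u. u \<in> pverts G \<Longrightarrow> sum f (parcs G `` {u}) = k * f u" for f k
    unfolding rho using that by (intro Max_ge[OF fin]) (auto simp: spectrum_eq_eigenfunctions[OF vs])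
qed

section \<open>Connectedness through sets closed under adjacency\<close>

text \<open>A closed set contains everything reachable from its members; conversely, the vertices
  reachable from \<open>u\<close> form a closed set. For nonempty \<open>W\<close>, disconnectedness
  thus yields one side of a cut.\<close>

lemma connected_induce_subgraph_iff:
  assumes "sym (parcs G)"
  shows "Digraph_Component.connected (with_proj G \<restriction> W) \<longleftrightarrow>
    W \<noteq> {} \<and> (\<forall>A\<subseteq>W. A \<noteq> {} \<and> (\<forall>u\<in>A. \<forall>v\<in>W. (u, v) \<in> parcs G \<longrightarrow> v \<in> A) \<longrightarrow> A = W)"
    (is "_ \<longleftrightarrow> _ \<and> ?R")
proof -
  define E where "E = {e \<in> parcs G. fst e \<in> W \<and> snd e \<in> W}"
  have "arcs_ends (with_proj G \<restriction> W) = E"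
    by (auto simp: arcs_ends_conv E_def)
  moreover have "symcl E = E"
    using assms by (auto simp: symcl_def E_def dest: symD)
  ultimately have conn: "Digraph_Component.connected (with_proj G \<restriction> W) \<longleftrightarrow>
    W \<noteq> {} \<and> (\<forall>u\<in>W. \<forall>v\<in>W. (u, v) \<in> rtrancl_on W E)" (is "_ \<longleftrightarrow> _ \<and> ?L")
    unfolding connected_conv by simp
  have "?R" if ?L
  proof (intro allI impI)
    fix A assume "A \<subseteq> W" and A: "A \<noteq> {} \<and> (\<forall>u\<in>A. \<forall>v\<in>W. (u, v) \<in> parcs G \<longrightarrow> v \<in> A)"
    then obtain u where u: "u \<in> A" "u \<in> W" by auto
    have "v \<in> A" if "(u, v) \<in> rtrancl_on W E" for v
      using that
    proof (induction rule: rtrancl_on_induct)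
      case base
      then show ?case using u by simp
    next
      case (step y z)
      then show ?case using A by (auto simp: E_def)
    qed
    then show "A = W" using \<open>?L\<close> u \<open>A \<subseteq> W\<close> by auto
  qed
  moreover have "?L" if ?R
  proof (intro ballI)
    fix u v assume uv: "u \<in> W" "v \<in> W"
    let ?A = "{v \<in> W. (u, v) \<in> rtrancl_on W E}"
    have "?A = W"
      using uv by (intro \<open>?R\<close>[rule_format])
        (auto simp: E_def intro: rtrancl_on_into_rtrancl_on)
    then show "(u, v) \<in> rtrancl_on W E" using uv by auto
  qed
  ultimately show ?thesis unfolding conn by blast
qed

lemma (in pair_graph) connected_iff:
  "Digraph_Component.connected (with_proj G) \<longleftrightarrow>
    pverts G \<noteq> {} \<and>
    (\<forall>A\<subseteq>pverts G. A \<noteq> {} \<and> (\<forall>u\<in>A. \<forall>v\<in>pverts G. (u, v) \<in> parcs G \<longrightarrow> v \<in> A) \<longrightarrow> A = pverts G)"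
proof -
  have "with_proj G \<restriction> pverts G = with_proj G"
    by (auto simp: induce_subgraph_def with_proj_def dest: arc_fst_in_verts arc_snd_in_verts)
  moreover have "sym (parcs G)" using parcs_sym by (auto intro: symI)
  ultimately show ?thesis using connected_induce_subgraph_iff[of G "pverts G"] by simp
qed

section \<open>Comparison with positive supersolutions\<close>

text \<open>
  Compare a supersolution \<open>w\<close> with an eigenfunction \<open>f\<close> at a vertex maximising \<open>|f|/w\<close>; in the
  equality case the set of maximisers is closed under adjacency.
\<close>

lemma (in pair_graph)
  fixes w :: "'a \<Rightarrow> real"
  assumes ne: "pverts G \<noteq> {}"
    and pos: "\<And>u. u \<in> pverts G \<Longrightarrow> w u > 0"
    and super: "\<And>u. u \<in> pverts G \<Longrightarrow> sum w (parcs G `` {u}) \<le> c * w u"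
  shows spectral_radius_le_supersolution: "\<rho> G \<le> c"
    and supersolution_eq: "\<lbrakk>Digraph_Component.connected (with_proj G); \<rho> G \<ge> c; u \<in> pverts G\<rbrakk>
        \<Longrightarrow> sum w (parcs G `` {u}) = c * w u"
proof -
  let ?r = "\<rho> G" and ?N = "\<lambda>u. parcs G `` {u}"
  obtain f where f: "\<exists>v\<in>pverts G. f v \<noteq> 0"
    "\<And>u. u \<in> pverts G \<Longrightarrow> sum f (?N u) = ?r * f u"
    using spectral_radius_eigenfunction[OF ne] by auto
  \<comment> \<open>\<open>M\<close> is the least constant with |f| \<le> M w, and \<open>U\<close>
    is where equality holds.\<close>
  define M where "M = Max ((\<lambda>u. \<bar>f u\<bar> / w u) ` pverts G)"
  have M0: "\<bar>f u\<bar> / w u \<le> M" if "u \<in> pverts G" for u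
    unfolding M_def using that pair_finite_verts by (intro Max_ge) auto
  have M: "\<bar>f u\<bar> \<le> M * w u" if "u \<in> pverts G" for u
    using M0[OF that] pos[OF that] by (simp add: pos_divide_le_eq)
  define U where "U = {u \<in> pverts G. \<bar>f u\<bar> = M * w u}"
  have "M \<in> (\<lambda>u. \<bar>f u\<bar> / w u) ` pverts G"
    unfolding M_def using ne pair_finite_verts by (intro Max_in) auto
  then obtain x where x: "x \<in> U" unfolding U_def using pos by force
  obtain v where v: "v \<in> pverts G" "\<bar>f v\<bar> > 0" using f(1) by auto
  then have "0 < M * w v" using M by fastforce
  then have "M > 0" using pos[OF v(1)] by (simp add: zero_less_mult_iff)
  have NV: "?N u \<subseteq> pverts G" for u using in_arcsD2 by auto
  have step1: "\<bar>?r\<bar> * \<bar>f u\<bar> \<le> (\<Sum>v\<in>?N u. \<bar>f v\<bar>)" if "u \<in> pverts G" for u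
    using f(2)[OF that] by (metis abs_mult sum_abs)
  have step2: "(\<Sum>v\<in>?N u. \<bar>f v\<bar>) \<le> M * sum w (?N u)" for u
    unfolding sum_distrib_left using NV M by (intro sum_mono) auto
  have step3: "M * sum w (?N u) \<le> M * (c * w u)" if "u \<in> pverts G" for u
    using super[OF that] \<open>M > 0\<close> by simp
  \<comment> \<open>Since |f| = M w at \<open>x\<close>, the three estimates chain there; cancelling
    M w(x) > 0 bounds |\<rho>|.\<close>
  have "\<bar>?r\<bar> * (M * w x) \<le> c * (M * w x)"
    using step1[of x] step2[of x] step3[of x] x by (auto simp: U_def algebra_simps)
  moreover have "M * w x > 0" using \<open>M > 0\<close> pos x by (simp add: U_def)
  ultimately have "\<bar>?r\<bar> \<le> c" by (rule mult_right_le_imp_le)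
  then show le: "?r \<le> c" by simp
  show "sum w (?N u) = c * w u"
    if conn: "Digraph_Component.connected (with_proj G)" and "?r \<ge> c" and u: "u \<in> pverts G"
  proof -
    have "\<bar>?r\<bar> = c" using \<open>\<bar>?r\<bar> \<le> c\<close> \<open>?r \<ge> c\<close> by simp
    \<comment> \<open>On \<open>U\<close> the two ends of the chain now agree, so every link is an
      equality.\<close>
    have chain: "(\<Sum>v\<in>?N u. \<bar>f v\<bar>) = M * sum w (?N u) \<and> M * sum w (?N u) = M * (c * w u)"
      if "u \<in> U" for u
    proof -
      have "\<bar>?r\<bar> * \<bar>f u\<bar> = M * (c * w u)" using that \<open>\<bar>?r\<bar> = c\<close> by (simp add: U_def)
      moreover have "u \<in> pverts G" using that by (simp add: U_def)
      ultimately show ?thesis using step1[of u] step2[of u] step3[of u] by linarith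
    qed
    have "v \<in> U" if "u \<in> U" "(u, v) \<in> parcs G" for u v
    proof -
      \<comment> \<open>Nonnegative gaps with sum zero all vanish, so neighbours of maximisers are
        maximisers.\<close>
      have "(\<Sum>v\<in>?N u. M * w v - \<bar>f v\<bar>) = 0"
        using chain[OF that(1)] by (simp add: sum_subtractf sum_distrib_left)
      moreover have "finite (?N u)" using NV pair_finite_verts by (rule finite_subset)
      moreover have "\<And>v. v \<in> ?N u \<Longrightarrow> 0 \<le> M * w v - \<bar>f v\<bar>" using M NV by auto
      ultimately have "M * w v - \<bar>f v\<bar> = 0"
        using that(2) by (subst (asm) sum_nonneg_eq_0_iff) auto
      then show ?thesis using in_arcsD2[OF that(2)] by (simp add: U_def)
    qed
    moreover have "U \<subseteq> pverts G" "U \<noteq> {}" using x by (auto simp: U_def)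
    ultimately have "U = pverts G" using conn unfolding connected_iff by blast
    then show ?thesis using chain[of u] u \<open>M > 0\<close> by simp
  qed
qed

section \<open>Real inequalities for the cut parameters\<close>

text \<open>With \<open>k = \<delta> - 1\<close> and \<open>m = n - \<delta> - 1\<close>, \<open>q\<close> is the cubic of the theorem at \<open>\<lambda> = t - 1\<close>.\<close>

lemma cubic_largest_root:
  fixes k m :: real and q :: "real \<Rightarrow> real"
  defines "q \<equiv> \<lambda>t. t * (t - 2) * (t - m) - k * (t\<^sup>2 - 2 * m)"
  assumes k: "k \<ge> 1" and m: "m \<ge> 0"
  shows "\<exists>t>2. t > m \<and> k * (1 / (t - 2) + 1 / (t - m) - 1 / t) = 1 \<and> q t = 0 \<and>
    (\<forall>s. q s = 0 \<longrightarrow> s \<le> t)"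
proof -
  let ?\<phi> = "\<lambda>t. k * (1 / (t - 2) + 1 / (t - m) - 1 / t)"
  \<comment> \<open>Beyond both poles 2 and \<open>m\<close>, the zeros of \<open>q\<close> are
    exactly the solutions of \<open>?\<phi> t = 1\<close>.\<close>
  have q: "q t = t * (t - 2) * (t - m) * (1 - ?\<phi> t)" if "t > 2" "t > m" for t
  proof -
    have "t * x * y * (1 - k * (1 / x + 1 / y - 1 / t)) = t * x * y - k * (t * y + t * x - x * y)"
      if "x \<noteq> 0" "y \<noteq> 0" for x y
      using that \<open>t > 2\<close> by (simp add: field_simps)
    from this[of "t - 2" "t - m"] show ?thesis
      using that by (simp add: q_def algebra_simps power2_eq_square)
  qed
  \<comment> \<open>Any t \<ge> \<open>?a\<close> exceeds both 2 and \<open>m\<close>. At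
    \<open>?a\<close> the cubic is nonpositive whichever entry is the maximum, and at
    \<open>k + m + 2\<close> it is nonnegative.\<close>
  let ?a = "max (k + 2) (m + 1)"
  have "q (k + 2) = - (k\<^sup>2 * m)" "q (m + 1) = m\<^sup>2 - 1 - k * (m\<^sup>2 + 1)"
    by (simp_all add: q_def algebra_simps power2_eq_square)
  moreover have "k * (m\<^sup>2 + 1) \<ge> 1 * (m\<^sup>2 + 1)" using k by (intro mult_right_mono) auto
  ultimately have "q ?a \<le> 0" using m by (auto simp: max_def)
  moreover have "q (k + m + 2) = 2 * m * (k + m + 2) + 2 * m * k"
    by (simp add: q_def algebra_simps power2_eq_square)
  then have "q (k + m + 2) \<ge> 0" using k m by simp
  moreover have "?a \<le> k + m + 2" "continuous_on {?a..k + m + 2} q"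
    using k m by (auto simp: q_def intro!: continuous_intros)
  ultimately obtain t where t: "?a \<le> t" "q t = 0"
    using IVT'[of q ?a 0 "k + m + 2"] by auto
  then have t2: "t > 2" "t > m" using k by auto
  then have eq: "?\<phi> t = 1" using q[of t] t by simp
  \<comment> \<open>\<open>?\<phi>\<close> is strictly decreasing past \<open>t\<close>: pairing
    1/(s-2) with -1/s gives 2/(s(s-2)), which visibly decreases. So no larger zero exists.\<close>
  have "s \<le> t" if "q s = 0" for s
  proof (rule ccontr)
    assume "\<not> s \<le> t"
    then have s: "s > t" by simp
    have "2 / (s * (s - 2)) < 2 / (t * (t - 2))"
      using s t2 by (intro divide_strict_left_mono mult_strict_mono mult_pos_pos) auto
    moreover have "1 / (s - 2) - 1 / s = 2 / (s * (s - 2))" "1 / (t - 2) - 1 / t = 2 / (t * (t - 2))"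
      using s t2 by (auto simp: field_simps)
    moreover have "1 / (s - m) < 1 / (t - m)" using s t2 by (simp add: field_simps)
    ultimately have "?\<phi> s < ?\<phi> t" using k by (intro mult_strict_left_mono) auto
    then have "?\<phi> s < 1" using eq by simp
    moreover have "?\<phi> s = 1" using q[of s] s t2 that by simp
    ultimately show False by simp
  qed
  then show ?thesis using t2 eq t by blast
qed

text \<open>Both sums of reciprocals have numerator \<open>\<sigma>\<close>, as a + b = c + m. Their
  denominators differ by (a-c)(b-c) \<ge> 0, which vanishes only if one of the two parts equals
  \<open>c\<close>.\<close>

lemma sum_of_reciprocals_spread:
  fixes a b c m t :: real
  assumes "a + b = c + m" "a \<ge> c" "b \<ge> c" "t > m"
  shows "1 / (t - a) + 1 / (t - b) \<le> 1 / (t - c) + 1 / (t - m)"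
    and "1 / (t - a) + 1 / (t - b) = 1 / (t - c) + 1 / (t - m) \<Longrightarrow> a = c \<or> b = c"
proof -
  have pos: "t - a > 0" "t - b > 0" "t - c > 0" "t - m > 0" using assms by auto
  have m: "m = a + b - c" using assms by simp
  define P Q \<sigma> where "P = (t - a) * (t - b)" and "Q = (t - c) * (t - m)" and "\<sigma> = 2 * t - c - m"
  have "P > 0" "Q > 0" "\<sigma> > 0" using pos by (auto simp: P_def Q_def \<sigma>_def)
  have L: "1 / (t - a) + 1 / (t - b) = \<sigma> / P" and R: "1 / (t - c) + 1 / (t - m) = \<sigma> / Q"
    using pos assms(1) by (simp_all add: P_def Q_def \<sigma>_def add_frac_eq)
  have PQ: "P - Q = (a - c) * (b - c)" unfolding P_def Q_def m by (simp add: algebra_simps)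
  have "P \<ge> Q" using PQ assms(2,3) by (smt (verit) mult_nonneg_nonneg)
  then show "1 / (t - a) + 1 / (t - b) \<le> 1 / (t - c) + 1 / (t - m)"
    unfolding L R using \<open>Q > 0\<close> \<open>\<sigma> > 0\<close> by (intro divide_left_mono) auto
  assume "1 / (t - a) + 1 / (t - b) = 1 / (t - c) + 1 / (t - m)"
  then have "P = Q" unfolding L R using \<open>P > 0\<close> \<open>Q > 0\<close> \<open>\<sigma> > 0\<close> by (simp add: frac_eq_eq)
  then show "a = c \<or> b = c" using PQ by simp
qed

text \<open>For fixed \<open>k\<close>, spreading replaces (a, b) by (c, m) with c = k0 + 2 - k, the
  least size the degree condition allows. Raising \<open>k\<close> to \<open>k0\<close> then
  increases k/(t-c) weakly and k(1/(t-m) - 1/t) strictly. Equality therefore forces k = k0, whence c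
  = 2.\<close>

lemma cut_parameters_extremal:
  fixes k k0 a b m t :: real
  assumes k: "0 < k" "k \<le> k0" and ab: "a \<ge> k0 + 2 - k" "b \<ge> k0 + 2 - k"
    and n: "k + a + b = k0 + 2 + m" and t: "t > 2" "t > m"
    and root: "k0 * (1 / (t - 2) + 1 / (t - m) - 1 / t) = 1"
  shows "k * (1 / (t - a) + 1 / (t - b) - 1 / t) \<le> 1"
    and "k * (1 / (t - a) + 1 / (t - b) - 1 / t) = 1 \<Longrightarrow> k = k0 \<and> (a = 2 \<or> b = 2)"
proof -
  define c where "c = k0 + 2 - k"
  have "c \<le> m" "m > 0" "c \<ge> 2" using ab n k by (auto simp: c_def)
  have m': "1 / (t - m) - 1 / t > 0" using \<open>m > 0\<close> t by (simp add: field_simps)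
  \<comment> \<open>The second summand is positive, so the first is below 1. This gives t - 2 > k0,
    the sign that makes (k0-k)(t-2-k0) nonnegative below.\<close>
  have "k0 * (1 / (t - 2)) + k0 * (1 / (t - m) - 1 / t) = 1"
    using root by (simp add: algebra_simps)
  moreover have "k0 * (1 / (t - m) - 1 / t) > 0" using m' k by simp
  ultimately have "k0 * (1 / (t - 2)) < 1" by linarith
  then have "t - 2 > k0" using t by (simp add: field_simps)
  have "k / (t - c) \<le> k0 / (t - 2)"
  proof -
    have "k * (t - 2) \<le> k0 * (t - c)"
    proof -
      have "k0 * (t - c) - k * (t - 2) = (k0 - k) * (t - 2 - k0)"
        unfolding c_def by (simp add: algebra_simps)
      then show ?thesis using k \<open>t - 2 > k0\<close> by (smt (verit) mult_nonneg_nonneg)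
    qed
    then show ?thesis using t \<open>c \<le> m\<close> by (simp add: field_simps)
  qed
  moreover have "k * (1 / (t - m) - 1 / t) \<le> k0 * (1 / (t - m) - 1 / t)"
    using k m' by (intro mult_right_mono) auto
  moreover have "k * (1 / (t - m) - 1 / t) = k0 * (1 / (t - m) - 1 / t) \<Longrightarrow> k = k0"
    using mult_right_cancel[of "1 / (t - m) - 1 / t" k k0] m' by linarith
  moreover have "k * (1 / (t - a) + 1 / (t - b)) \<le> k * (1 / (t - c) + 1 / (t - m))"
    using sum_of_reciprocals_spread(1)[of a b c m t] k ab n t c_def
    by (intro mult_left_mono) auto
  moreover have "k * (1 / (t - a) + 1 / (t - b)) = k * (1 / (t - c) + 1 / (t - m)) \<Longrightarrow> a = c \<or> b = c"
    using sum_of_reciprocals_spread(2)[of a b c m t] k ab n t c_def by auto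
  moreover note root
  ultimately show "k * (1 / (t - a) + 1 / (t - b) - 1 / t) \<le> 1"
    and "k * (1 / (t - a) + 1 / (t - b) - 1 / t) = 1 \<Longrightarrow> k = k0 \<and> (a = 2 \<or> b = 2)"
    unfolding distrib_left right_diff_distrib c_def by auto
qed

section \<open>Joins of cliques and their isomorphisms\<close>

text \<open>\<open>G\<close> is the join of a clique on \<open>S\<close> with the disjoint union of cliques on \<open>A\<close> and \<open>B\<close>.\<close>

definition clique_join :: "'a pair_pre_digraph \<Rightarrow> 'a set \<Rightarrow> 'a set \<Rightarrow> 'a set \<Rightarrow> bool" where
  "clique_join G S A B \<longleftrightarrow>
    pverts G = S \<union> A \<union> B \<and> S \<inter> A = {} \<and> S \<inter> B = {} \<and> A \<inter> B = {} \<and>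
    parcs G = {(u, v). u \<in> pverts G \<and> v \<in> pverts G \<and> u \<noteq> v \<and>
      \<not> (u \<in> A \<and> v \<in> B) \<and> \<not> (u \<in> B \<and> v \<in> A)}"

lemma clique_joinD:
  assumes "clique_join G S A B"
  shows "pverts G = S \<union> A \<union> B" "S \<inter> A = {}" "S \<inter> B = {}" "A \<inter> B = {}"
    and "parcs G = {(u, v). u \<in> pverts G \<and> v \<in> pverts G \<and> u \<noteq> v \<and>
      \<not> (u \<in> A \<and> v \<in> B) \<and> \<not> (u \<in> B \<and> v \<in> A)}"
    and "u \<in> A \<Longrightarrow> v \<in> B \<Longrightarrow> (u, v) \<notin> parcs G"
  using assms unfolding clique_join_def by blast+

lemma clique_join_swap:
  assumes "clique_join G S A B"
  shows "clique_join G S B A"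
proof -
  note V = clique_joinD(1-4)[OF assms] and E = clique_joinD(5)[OF assms]
  have "parcs G = {(u, v). u \<in> pverts G \<and> v \<in> pverts G \<and> u \<noteq> v \<and>
      \<not> (u \<in> B \<and> v \<in> A) \<and> \<not> (u \<in> A \<and> v \<in> B)}"
    unfolding E by blast
  then show ?thesis using V unfolding clique_join_def by blast
qed

lemma pair_graph_clique_join:
  assumes "clique_join G S A B" "finite (pverts G)"
  shows "pair_graph G"
proof -
  note * = clique_joinD(5)[OF assms(1)]
  have "parcs G \<subseteq> pverts G \<times> pverts G" using * by auto
  then have "finite (parcs G)" using assms(2) finite_SigmaI finite_subset by metis
  then show ?thesis
    using assms(2) by unfold_locales (auto simp: * symmetric_def intro!: symI)
qed

lemma parcs_disjoint_union_simps [simp]: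
  "(Inl x, Inl y) \<in> parcs (disjoint_union G H) \<longleftrightarrow> (x, y) \<in> parcs G"
  "(Inr x', Inr y') \<in> parcs (disjoint_union G H) \<longleftrightarrow> (x', y') \<in> parcs H"
  "(Inl x, Inr y') \<notin> parcs (disjoint_union G H)"
  "(Inr x', Inl y) \<notin> parcs (disjoint_union G H)"
  by (auto simp: disjoint_union_def)

lemma parcs_graph_join_simps [simp]:
  "(Inl x, Inl y) \<in> parcs (graph_join G H) \<longleftrightarrow> (x, y) \<in> parcs G"
  "(Inr x', Inr y') \<in> parcs (graph_join G H) \<longleftrightarrow> (x', y') \<in> parcs H"
  "(Inl x, Inr y') \<in> parcs (graph_join G H) \<longleftrightarrow> x \<in> pverts G \<and> y' \<in> pverts H"
  "(Inr x', Inl y) \<in> parcs (graph_join G H) \<longleftrightarrow> x' \<in> pverts H \<and> y \<in> pverts G"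
  by (auto simp: graph_join_def)

lemma clique_join_graph_join:
  "clique_join (graph_join (complete_graph k) (disjoint_union (complete_graph a) (complete_graph b)))
    (Inl ` {..<k}) (Inr ` Inl ` {..<a}) (Inr ` Inr ` {..<b})"
  (is "clique_join ?H ?S ?A ?B")
proof -
  have V: "pverts ?H = ?S \<union> ?A \<union> ?B"
    by (auto simp: graph_join_def disjoint_union_def complete_graph_def)
  have mem: "Inl i \<in> pverts ?H \<longleftrightarrow> i < k" "Inr (Inl j) \<in> pverts ?H \<longleftrightarrow> j < a"
    "Inr (Inr l) \<in> pverts ?H \<longleftrightarrow> l < b" "Inl i \<notin> ?A" "Inl i \<notin> ?B"
    "Inr (Inl j) \<in> ?A \<longleftrightarrow> j < a" "Inr (Inl j) \<notin> ?B" "Inr (Inr l) \<notin> ?A"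
    "Inr (Inr l) \<in> ?B \<longleftrightarrow> l < b" for i j l
    unfolding V by (simp_all add: image_iff)
  have W: "pverts (disjoint_union (complete_graph a) (complete_graph b)) = {..<a} <+> {..<b}"
    "pverts (complete_graph k) = {..<k}"
    "(x, y) \<in> parcs (complete_graph c) \<longleftrightarrow> x < c \<and> y < c \<and> x \<noteq> y" for c x y
    by (auto simp: disjoint_union_def complete_graph_def)
  have P: "Inl j \<in> {..<a} <+> {..<b} \<longleftrightarrow> j < a" "Inr j \<in> {..<a} <+> {..<b} \<longleftrightarrow> j < b" for j
    by auto
  have "\<forall>u v. (u, v) \<in> parcs ?H \<longleftrightarrow> u \<in> pverts ?H \<and> v \<in> pverts ?H \<and> u \<noteq> v \<and>
      \<not> (u \<in> ?A \<and> v \<in> ?B) \<and> \<not> (u \<in> ?B \<and> v \<in> ?A)"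
    unfolding split_sum_all by (simp add: mem W P conj_ac)
  then have "parcs ?H = {(u, v). u \<in> pverts ?H \<and> v \<in> pverts ?H \<and> u \<noteq> v \<and>
      \<not> (u \<in> ?A \<and> v \<in> ?B) \<and> \<not> (u \<in> ?B \<and> v \<in> ?A)}" by auto
  then show ?thesis using V unfolding clique_join_def by blast
qed

text \<open>Adjacency depends only on distinctness and on the parts containing the two vertices, so
  gluing bijections between corresponding parts gives an isomorphism.\<close>

lemma digraph_iso_clique_join:
  assumes G: "clique_join G S A B" "finite (pverts G)"
    and H: "clique_join H S' A' B'" "finite (pverts H)"
    and card: "card S = card S'" "card A = card A'" "card B = card B'"
  shows "digraph_iso (with_proj G) (with_proj H)"
proof -
  interpret G: pair_graph G using pair_graph_clique_join[OF G] .
  note V = clique_joinD(1-4)[OF G(1)] and E = clique_joinD(5)[OF G(1)]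
  note V' = clique_joinD(1-4)[OF H(1)] and E' = clique_joinD(5)[OF H(1)]
  have fin: "finite S" "finite A" "finite B" "finite S'" "finite A'" "finite B'"
    using G(2) H(2) V(1) V'(1) by auto
  obtain f g h where f: "bij_betw f S S'" and g: "bij_betw g A A'" and h: "bij_betw h B B'"
    using finite_same_card_bij fin card by metis
  define \<phi> where "\<phi> u = (if u \<in> S then f u else if u \<in> A then g u else h u)" for u
  have \<phi>: "bij_betw \<phi> S S'" "bij_betw \<phi> A A'" "bij_betw \<phi> B B'"
  proof -
    have "\<And>u. u \<in> S \<Longrightarrow> \<phi> u = f u" "\<And>u. u \<in> A \<Longrightarrow> \<phi> u = g u" "\<And>u. u \<in> B \<Longrightarrow> \<phi> u = h u"
      using V(2-4) by (auto simp: \<phi>_def)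
    then show "bij_betw \<phi> S S'" "bij_betw \<phi> A A'" "bij_betw \<phi> B B'"
      using f g h by (auto cong: bij_betw_cong)
  qed
  have "bij_betw \<phi> (S \<union> A \<union> B) (S' \<union> A' \<union> B')"
    using \<phi> V V' by (intro bij_betw_combine) auto
  then have bij: "inj_on \<phi> (pverts G)" "\<phi> ` pverts G = pverts H"
    using V(1) V'(1) by (simp_all add: bij_betw_def)
  have mem: "\<phi> u \<in> A' \<longleftrightarrow> u \<in> A" "\<phi> u \<in> B' \<longleftrightarrow> u \<in> B" if "u \<in> pverts G" for u
    using that \<phi> V V' by (auto dest!: bij_betw_imp_surj_on)
  let ?i = "\<lparr>iso_verts = \<phi>, iso_arcs = map_prod \<phi> \<phi>, iso_head = snd, iso_tail = fst\<rparr>"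
  have sub: "parcs G \<subseteq> pverts G \<times> pverts G" using E by auto
  have "inj_on (map_prod \<phi> \<phi>) (pverts G \<times> pverts G)"
    using bij(1) by (rule map_prod_inj_on[OF _ bij(1)])
  then have inj: "inj_on (map_prod \<phi> \<phi>) (parcs G)" using sub by (rule inj_on_subset)
  have "map_prod \<phi> \<phi> ` parcs G = parcs H"
  proof (intro equalityI subsetI)
    fix e assume "e \<in> map_prod \<phi> \<phi> ` parcs G"
    then obtain u v where "(u, v) \<in> parcs G" "e = (\<phi> u, \<phi> v)" by auto
    then show "e \<in> parcs H"
      unfolding E E' using bij mem by (auto dest: inj_onD)
  next
    fix e assume e: "e \<in> parcs H"
    then obtain u v where uv: "u \<in> pverts G" "v \<in> pverts G" "e = (\<phi> u, \<phi> v)"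
      unfolding E' bij(2)[symmetric] by auto
    then have "(u, v) \<in> parcs G"
      using e mem unfolding E E' by auto
    then show "e \<in> map_prod \<phi> \<phi> ` parcs G" using uv by force
  qed
  then have "with_proj H = app_iso ?i (with_proj G)"
    using bij(2) by (simp add: app_iso_def with_proj_def)
  moreover have "pre_digraph.digraph_isomorphism (with_proj G) ?i"
    unfolding pre_digraph.digraph_isomorphism_def using G.wf_digraph_axioms bij(1) inj by simp
  ultimately show ?thesis unfolding digraph_iso_def by blast
qed

section \<open>Spectral bounds from a vertex cut\<close>

text \<open>The weights come from solving k + x y = t y for the value y on a clique of size x joined
  to \<open>S\<close> of total weight k (\<open>recip\<close>). Summing over both sides counts
  \<open>S\<close> twice, which explains the term -1/t in the formula on \<open>S\<close>.\<close>

lemma cut_weight_sums: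
  fixes t :: real
  assumes fin: "finite S" "finite A" "finite B"
    and disj: "S \<inter> A = {}" "S \<inter> B = {}" "A \<inter> B = {}"
    and t: "t > 0" "t > card A" "t > card B"
  defines "w \<equiv> \<lambda>u. if u \<in> S then 1 else card S / (t - (if u \<in> A then card A else card B))"
  shows "u \<in> S \<Longrightarrow> sum w (S \<union> A \<union> B - {u}) =
      t * (card S * (1 / (t - card A) + 1 / (t - card B) - 1 / t)) - 1"
    and "u \<in> A \<Longrightarrow> sum w (S \<union> A - {u}) = (t - 1) * w u"
    and "u \<in> B \<Longrightarrow> sum w (S \<union> B - {u}) = (t - 1) * w u"
proof -
  have wS: "sum w S = card S" by (simp add: w_def)
  have "sum w A = (\<Sum>u\<in>A. card S / (t - card A))"
    using disj by (intro sum.cong) (auto simp: w_def)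
  then have wA: "sum w A = card A * (card S / (t - card A))" by simp
  have "sum w B = (\<Sum>u\<in>B. card S / (t - card B))"
    using disj by (intro sum.cong) (auto simp: w_def)
  then have wB: "sum w B = card B * (card S / (t - card B))" by simp
  have SA: "sum w (S \<union> A) = sum w S + sum w A"
    and SB: "sum w (S \<union> B) = sum w S + sum w B"
    and SAB: "sum w (S \<union> A \<union> B) = sum w S + sum w A + sum w B"
    using fin disj by (simp_all add: sum.union_disjoint Int_Un_distrib2)
  have rm: "sum w (X - {u}) = sum w X - w u" if "u \<in> X" "finite X" for X u
    using that by (simp add: sum_diff1)
  have recip: "k + x * (k / (t - x)) = t * (k / (t - x))" if "t > x" for k x
    using that by (simp add: field_simps)
  show "sum w (S \<union> A - {u}) = (t - 1) * w u" if "u \<in> A"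
  proof -
    have "w u = card S / (t - card A)" using that disj by (auto simp: w_def)
    then show ?thesis
      using rm[of u "S \<union> A"] that fin recip[OF t(2), of "card S"]
      by (simp only: SA wS wA left_diff_distrib) simp
  qed
  show "sum w (S \<union> B - {u}) = (t - 1) * w u" if "u \<in> B"
  proof -
    have "w u = card S / (t - card B)" using that disj by (auto simp: w_def)
    then show ?thesis
      using rm[of u "S \<union> B"] that fin recip[OF t(3), of "card S"]
      by (simp only: SB wS wB left_diff_distrib) simp
  qed
  show "sum w (S \<union> A \<union> B - {u}) =
      t * (card S * (1 / (t - card A) + 1 / (t - card B) - 1 / t)) - 1" if "u \<in> S"
  proof -
    have "t * (card S * (1 / (t - card A) + 1 / (t - card B) - 1 / t)) =
        t * (card S / (t - card A)) + t * (card S / (t - card B)) - card S"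
      using t(1) by (simp add: distrib_left right_diff_distrib)
    moreover have "w u = 1" using that by (simp add: w_def)
    ultimately show ?thesis
      using rm[of u "S \<union> A \<union> B"] that fin recip[OF t(2), of "card S"] recip[OF t(3), of "card S"]
      by (simp add: SAB wS wA wB)
  qed
qed

text \<open>The cut makes \<open>G\<close> a spanning subgraph of the full clique join, for which
  \<open>w\<close> is a supersolution with eigenvalue bound \<open>t - 1\<close> when \<Phi> \<le>
  1. The three claims are the bound, its equality case, and its sharpness.\<close>

lemma (in pair_graph)
  fixes t :: real
  assumes V: "pverts G = S \<union> A \<union> B"
    and disj: "S \<inter> A = {}" "S \<inter> B = {}" "A \<inter> B = {}"
    and sep: "\<And>u v. u \<in> A \<Longrightarrow> v \<in> B \<Longrightarrow> (u, v) \<notin> parcs G"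
    and S: "S \<noteq> {}" and t: "t > 0" "t > card A" "t > card B"
  defines "\<Phi> \<equiv> card S * (1 / (t - card A) + 1 / (t - card B) - 1 / t)"
  shows spectral_radius_cut_le: "\<Phi> \<le> 1 \<Longrightarrow> \<rho> G \<le> t - 1"
    and spectral_radius_cut_eq: "\<lbrakk>\<Phi> \<le> 1; Digraph_Component.connected (with_proj G); \<rho> G \<ge> t - 1\<rbrakk>
      \<Longrightarrow> clique_join G S A B \<and> \<Phi> = 1"
    and spectral_radius_clique_join: "\<lbrakk>clique_join G S A B; \<Phi> = 1\<rbrakk> \<Longrightarrow> \<rho> G = t - 1"
proof -
  define w where "w u = (if u \<in> S then 1 else card S / (t - (if u \<in> A then card A else card B)))" for u
  have fin: "finite S" "finite A" "finite B" using pair_finite_verts V by auto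
  note sums = cut_weight_sums[OF fin disj t, folded w_def \<Phi>_def]
  \<comment> \<open>\<open>F u\<close> is the neighbourhood of \<open>u\<close> in the full clique
    join.\<close>
  define F where "F u = (if u \<in> S then S \<union> A \<union> B - {u} else if u \<in> A then S \<union> A - {u} else S \<union> B - {u})" for u
  let ?N = "\<lambda>u. parcs G `` {u}"
  have sep': "(u, v) \<notin> parcs G" if "u \<in> B" "v \<in> A" for u v
    using sep[OF that(2,1)] parcs_sym by blast
  have NF: "?N u \<subseteq> F u" if "u \<in> pverts G" for u
    using that in_arcsD2[of u] no_loops'[of u] sep[of u] sep'[of u] V unfolding F_def by auto
  have finF: "finite (F u)" for u using fin by (simp add: F_def)
  have FV: "F u \<subseteq> pverts G" for u using V by (auto simp: F_def)
  have "card S > 0" using S fin by (simp add: card_gt_0_iff)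
  then have pos: "w u > 0" for u using t by (simp add: w_def)
  have F: "sum w (F u) = (t - 1) * w u + (if u \<in> S then t * \<Phi> - t else 0)" if "u \<in> pverts G" for u
    using that sums(1)[of u] sums(2)[of u] sums(3)[of u] V disj
    by (auto simp: F_def w_def[of u] algebra_simps)
  have ne: "pverts G \<noteq> {}" using V S by auto
  have N_le: "sum w (?N u) \<le> sum w (F u)" if "u \<in> pverts G" for u
    using NF[OF that] finF pos by (intro sum_mono2) (auto intro: less_imp_le)
  have F_le: "sum w (F u) \<le> (t - 1) * w u" if "u \<in> pverts G" "\<Phi> \<le> 1" for u
    using F[OF that(1)] mult_left_mono[OF that(2), of t] t by auto
  show le: "\<rho> G \<le> t - 1" if "\<Phi> \<le> 1"
    using spectral_radius_le_supersolution[OF ne pos order_trans[OF N_le F_le]] that by blast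
  show "clique_join G S A B \<and> \<Phi> = 1"
    if "\<Phi> \<le> 1" "Digraph_Component.connected (with_proj G)" "\<rho> G \<ge> t - 1"
  proof
    have eq: "sum w (?N u) = (t - 1) * w u" if "u \<in> pverts G" for u
      using supersolution_eq[OF ne pos order_trans[OF N_le F_le]] that
        \<open>\<Phi> \<le> 1\<close> \<open>Digraph_Component.connected (with_proj G)\<close> \<open>\<rho> G \<ge> t - 1\<close> by blast
    obtain u where "u \<in> S" using S by auto
    \<comment> \<open>At a vertex of \<open>S\<close>, equality for \<open>G\<close> leaves no room
      for the deficit t - t \<Phi> of the full join.\<close>
    then have "t * 1 \<le> t * \<Phi>" using eq[of u] N_le[of u] F[of u] V by auto
    then show "\<Phi> = 1" using \<open>\<Phi> \<le> 1\<close> t(1) by simp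
    \<comment> \<open>All weights are positive, so one missing neighbour would make the sum strictly
      too small.\<close>
    have N: "?N u = F u" if u: "u \<in> pverts G" for u
    proof (rule ccontr)
      assume "?N u \<noteq> F u"
      then obtain v where "v \<in> F u - ?N u" using NF[OF u] by auto
      then have "sum w (?N u) < sum w (F u)"
        using NF[OF u] finF pos by (intro sum_strict_mono2[where b = v]) (auto intro: less_imp_le)
      then show False using eq[OF u] F_le[OF u \<open>\<Phi> \<le> 1\<close>] by simp
    qed
    have "(u, v) \<in> parcs G \<longleftrightarrow> u \<in> pverts G \<and> v \<in> pverts G \<and> u \<noteq> v \<and>
      \<not> (u \<in> A \<and> v \<in> B) \<and> \<not> (u \<in> B \<and> v \<in> A)" for u v
    proof (cases "u \<in> pverts G")
      case True
      have "(u, v) \<in> parcs G \<longleftrightarrow> v \<in> F u" using N[OF True] by auto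
      then show ?thesis using True disj unfolding F_def V by auto
    qed (auto dest: in_arcsD1)
    then have "parcs G = {(u, v). u \<in> pverts G \<and> v \<in> pverts G \<and> u \<noteq> v \<and>
      \<not> (u \<in> A \<and> v \<in> B) \<and> \<not> (u \<in> B \<and> v \<in> A)}" by auto
    then show "clique_join G S A B" unfolding clique_join_def using V disj by blast
  qed
  show "\<rho> G = t - 1" if cj: "clique_join G S A B" and "\<Phi> = 1"
  proof (rule antisym)
    show "\<rho> G \<le> t - 1" using le \<open>\<Phi> = 1\<close> by simp
    note arcs = clique_joinD(5)[OF cj]
    \<comment> \<open>No edge is missing, so with \<Phi> = 1 the supersolution \<open>w\<close> is
      an eigenfunction.\<close>
    have "?N u = F u" if "u \<in> pverts G" for u
      using that disj unfolding arcs V F_def by auto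
    then have "sum w (?N u) = (t - 1) * w u" if "u \<in> pverts G" for u
      using F[OF that] that \<open>\<Phi> = 1\<close> by simp
    then show "t - 1 \<le> \<rho> G"
      by (intro eigenvalue_le_spectral_radius[OF ne, of w])
        (use ne pos in \<open>auto simp: less_imp_neq[symmetric]\<close>)
  qed
qed

section \<open>Minimum degree, cuts and vertex-connectivity\<close>

lemma (in pair_graph) out_degree_eq: "out_degree (with_proj G) u = card (parcs G `` {u})"
proof -
  have "out_arcs (with_proj G) u = Pair u ` (parcs G `` {u})"
    by (auto simp: out_arcs_def)
  then show ?thesis unfolding out_degree_def by (simp add: card_image inj_on_def)
qed

lemma (in pair_graph) min_degree_le: "u \<in> pverts G \<Longrightarrow> min_degree G \<le> card (parcs G `` {u})"
  unfolding min_degree_def out_degree_eq[symmetric] using pair_finite_verts by (intro Min_le) auto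

lemma (in pair_graph) min_degree_attained:
  "pverts G \<noteq> {} \<Longrightarrow> \<exists>u\<in>pverts G. card (parcs G `` {u}) = min_degree G"
proof -
  assume "pverts G \<noteq> {}"
  then have "min_degree G \<in> out_degree (with_proj G) ` pverts G"
    unfolding min_degree_def using pair_finite_verts by (intro Min_in) auto
  then show ?thesis unfolding out_degree_eq image_iff by metis
qed

lemma (in pair_graph) separating_set_cut:
  assumes "S \<subset> pverts G" "\<not> Digraph_Component.connected (with_proj G \<restriction> (pverts G - S))"
  obtains A B where "pverts G = S \<union> A \<union> B" "S \<inter> A = {}" "S \<inter> B = {}" "A \<inter> B = {}"
    "A \<noteq> {}" "B \<noteq> {}" "A \<times> B \<inter> parcs G = {}"
proof -
  have sym: "sym (parcs G)" using parcs_sym by (auto intro: symI)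
  obtain A where A: "A \<subseteq> pverts G - S" "A \<noteq> {}" "A \<noteq> pverts G - S"
    "\<forall>u\<in>A. \<forall>v\<in>pverts G - S. (u, v) \<in> parcs G \<longrightarrow> v \<in> A"
    using assms connected_induce_subgraph_iff[OF sym, of "pverts G - S"] by blast
  show ?thesis
    by (rule that[of A "pverts G - S - A"]) (use A assms(1) in blast)+
qed

text \<open>In a non-complete graph the neighbourhood of a vertex of minimum degree is a separating
  set, so the \<open>Min\<close> is attained and at most \<delta>. A complete graph has equality, so
  strict inequality always supplies a cut.\<close>

lemma (in pair_graph) vertex_connectivity_le_min_degree:
  assumes ne: "pverts G \<noteq> {}"
  shows "vertex_connectivity G \<le> min_degree G"
    and "vertex_connectivity G < min_degree G \<Longrightarrow>
      \<exists>S\<subset>pverts G. \<not> Digraph_Component.connected (with_proj G \<restriction> (pverts G - S)) \<and>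
        card S = vertex_connectivity G"
proof -
  let ?n = "card (pverts G)"
  let ?C = "{S. S \<subset> pverts G \<and> \<not> Digraph_Component.connected (with_proj G \<restriction> (pverts G - S))}"
  have sub: "parcs G `` {u} \<subseteq> pverts G - {u}" for u
    using in_arcsD2 no_loops' by auto
  have "vertex_connectivity G \<le> min_degree G \<and> (vertex_connectivity G < min_degree G \<longrightarrow>
      (\<exists>S\<in>?C. card S = vertex_connectivity G))"
  proof (cases "K\<^bsub>?n\<^esub> (with_proj G)")
    case True
    obtain u where u: "u \<in> pverts G" "card (parcs G `` {u}) = min_degree G"
      using min_degree_attained[OF ne] by auto
    have "parcs G `` {u} = pverts G - {u}"
      using True u(1) unfolding complete_digraph_pair_def by auto
    then show ?thesis using True u pair_finite_verts by (simp add: vertex_connectivity_def)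
  next
    case False
    have "\<exists>S\<in>?C. card S = min_degree G"
    proof -
      obtain u where u: "u \<in> pverts G" "card (parcs G `` {u}) = min_degree G"
        using min_degree_attained[OF ne] by auto
      have "parcs G `` {u} \<noteq> pverts G - {u}"
      proof
        assume "parcs G `` {u} = pverts G - {u}"
        \<comment> \<open>If a vertex of minimum degree sees all others, then so does every vertex,
          and \<open>G\<close> is complete.\<close>
        then have "min_degree G = ?n - 1" using u pair_finite_verts by simp
        then have full: "parcs G `` {v} = pverts G - {v}" if "v \<in> pverts G" for v
          using min_degree_le[OF that] sub that pair_finite_verts by (intro card_seteq) auto
        have "(x, y) \<in> parcs G \<longleftrightarrow> x \<in> pverts G \<and> y \<in> pverts G \<and> x \<noteq> y" for x y
          using full[of x] in_arcsD1[of x y] by (cases "x \<in> pverts G") auto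
        then show False using False pair_finite_verts unfolding complete_digraph_pair_def by auto
      qed
      moreover have sym: "sym (parcs G)" using parcs_sym by (auto intro: symI)
      moreover have "parcs G `` {u} \<subset> pverts G" using sub u(1) by auto
      ultimately have "\<not> Digraph_Component.connected (with_proj G \<restriction> (pverts G - parcs G `` {u}))"
        using sub[of u] u(1) unfolding connected_induce_subgraph_iff[OF sym]
        by (auto intro!: exI[of _ "{u}"] dest: no_loops')
      then show ?thesis using u \<open>parcs G `` {u} \<subset> pverts G\<close> by blast
    qed
    moreover have "finite ?C" using pair_finite_verts by (intro finite_subset[of ?C "Pow (pverts G)"]) auto
    moreover have "vertex_connectivity G = Min (card ` ?C)"
      using False by (simp add: vertex_connectivity_def)
    moreover have "Min (card ` ?C) \<le> card S" if "S \<in> ?C" for S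
      using that \<open>finite ?C\<close> by (intro Min_le) auto
    moreover have "Min (card ` ?C) \<in> card ` ?C" if "S \<in> ?C" for S
      using that \<open>finite ?C\<close> by (intro Min_in) auto
    ultimately show ?thesis by (metis (no_types, lifting) imageE)
  qed
  then show "vertex_connectivity G \<le> min_degree G"
    and "vertex_connectivity G < min_degree G \<Longrightarrow>
      \<exists>S\<subset>pverts G. \<not> Digraph_Component.connected (with_proj G \<restriction> (pverts G - S)) \<and>
        card S = vertex_connectivity G"
    by blast+
qed

section \<open>Identification of \<rho>(H) and extremality of \<open>H\<close>\<close>

theorem theorem3p3:
  fixes G :: "'a pair_pre_digraph"
    and H :: "(nat + (nat + nat)) pair_pre_digraph"
    and n \<delta> \<kappa> :: nat
  assumes "pair_graph G"
    and "Digraph_Component.connected (with_proj G)"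
    and "card (pverts G) = n" and "n \<ge> 5"
    and "min_degree G = \<delta>" and "\<delta> \<ge> 2"
    and "vertex_connectivity G = \<kappa>"
    and "H = graph_join (complete_graph (\<delta> - 1))
               (disjoint_union (complete_graph 2) (complete_graph (n - \<delta> - 1)))"
  shows "(let p = (\<lambda>x::real. x ^ 3 - (real n - 3) * x ^ 2 - (2 * real \<delta> - 1) * x
                     + 2 * real \<delta> * (real n - real \<delta> - 1) - real n + 1)
          in p (\<rho> H) = 0 \<and> (\<forall>x. p x = 0 \<longrightarrow> x \<le> \<rho> H))
       \<and> (\<rho> G \<ge> \<rho> H \<longrightarrow> \<kappa> = \<delta> \<or> digraph_iso (with_proj G) (with_proj H))"
proof -
  interpret G: pair_graph G by (rule assms(1))
  have ne: "pverts G \<noteq> {}" using assms(3,4) by auto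
  have deg: "\<delta> \<le> card (parcs G `` {u})" if "u \<in> pverts G" for u
    using G.min_degree_le[OF that] assms(5) by simp
  \<comment> \<open>This makes the natural subtraction \<open>n - \<delta> - 1\<close> exact, giving
    n = k + m + 2, where \<open>m\<close> may be 0.\<close>
  have "\<delta> \<le> n - 1"
  proof -
    obtain u where u: "u \<in> pverts G" using ne by auto
    have "parcs G `` {u} \<subseteq> pverts G - {u}" using G.in_arcsD2 G.no_loops' by auto
    then have "card (parcs G `` {u}) \<le> card (pverts G - {u})"
      using G.pair_finite_verts by (intro card_mono) auto
    then show ?thesis using deg[OF u] u G.pair_finite_verts assms(3) by simp
  qed
  then have "\<delta> = (\<delta> - 1) + 1" "\<delta> - 1 \<ge> 1" "n = (\<delta> - 1) + (n - \<delta> - 1) + 2"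
    using assms(4,6) by linarith+
  then obtain k m where k: "\<delta> = k + 1" "k \<ge> 1" and m: "n = k + m + 2" by blast
  define \<Phi> where "\<Phi> t a b = 1 / (t - a) + 1 / (t - b) - 1 / t" for t a b :: real
  obtain t where t: "t > 2" "t > real m" and root: "real k * \<Phi> t 2 m = 1"
    and q: "t * (t - 2) * (t - real m) - real k * (t\<^sup>2 - 2 * real m) = 0"
    and largest: "\<And>s. s * (s - 2) * (s - real m) - real k * (s\<^sup>2 - 2 * real m) = 0 \<Longrightarrow> s \<le> t"
    using cubic_largest_root[of "real k" "real m"] k(2) unfolding \<Phi>_def by auto

  let ?S = "Inl ` {..<k} :: (nat + (nat + nat)) set" 
    and ?A = "Inr ` Inl ` {..<2} :: (nat + (nat + nat)) set"
    and ?B = "Inr ` Inr ` {..<m} :: (nat + (nat + nat)) set"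
  have H: "clique_join H ?S ?A ?B"
    using clique_join_graph_join[of k 2 m] assms(8) k m by simp
  note VH = clique_joinD(1-4)[OF H] and sepH = clique_joinD(6)[OF H]
  have finH: "finite (pverts H)" unfolding VH by simp
  interpret H: pair_graph H by (rule pair_graph_clique_join[OF H finH])
  have cardH: "card ?S = k" "card ?A = 2" "card ?B = m"
    by (simp_all add: card_image inj_on_def image_image)
  have "?S \<noteq> {}" using k(2) by (simp add: lessThan_empty_iff)
  \<comment> \<open>\<open>t\<close> was chosen so that \<Phi> = 1 for the parts of
    \<open>H\<close>, which are sharp for the bound.\<close>
  then have rho: "\<rho> H = t - 1"
    using H.spectral_radius_clique_join[OF VH sepH _ _ _ _ H, of t] t root
    unfolding cardH \<Phi>_def by simp

  let ?p = "\<lambda>x::real. x ^ 3 - (real n - 3) * x ^ 2 - (2 * real \<delta> - 1) * x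
    + 2 * real \<delta> * (real n - real \<delta> - 1) - real n + 1"
  have p: "?p (s - 1) = s * (s - 2) * (s - real m) - real k * (s\<^sup>2 - 2 * real m)" for s
    unfolding m k(1) by (simp add: algebra_simps power2_eq_square power3_eq_cube)
  have "?p (\<rho> H) = 0" using p[of t] q rho by simp
  moreover have "x \<le> \<rho> H" if "?p x = 0" for x
    using p[of "x + 1"] largest[of "x + 1"] that rho by simp
  moreover have "digraph_iso (with_proj G) (with_proj H)" if "\<rho> G \<ge> \<rho> H" "\<kappa> \<noteq> \<delta>"
  proof -
    have "\<kappa> < \<delta>"
      using G.vertex_connectivity_le_min_degree(1)[OF ne] assms(5,7) that(2) by simp
    then obtain S where S_sub: "S \<subset> pverts G" and S_card: "card S < \<delta>"
      and disc: "\<not> Digraph_Component.connected (with_proj G \<restriction> (pverts G - S))"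
      using G.vertex_connectivity_le_min_degree(2)[OF ne] assms(5,7) by metis
    obtain A B where V: "pverts G = S \<union> A \<union> B" "S \<inter> A = {}" "S \<inter> B = {}" "A \<inter> B = {}"
      and AB: "A \<noteq> {}" "B \<noteq> {}" and "A \<times> B \<inter> parcs G = {}"
      by (rule G.separating_set_cut[OF S_sub disc])
    then have sep: "(u, v) \<notin> parcs G" if "u \<in> A" "v \<in> B" for u v using that by blast
    have fin: "finite S" "finite A" "finite B" using V(1) G.pair_finite_verts by auto
    have "S \<noteq> {}"
    proof
      assume "S = {}"
      then have "A \<subseteq> pverts G" "\<forall>u\<in>A. \<forall>v\<in>pverts G. (u, v) \<in> parcs G \<longrightarrow> v \<in> A"
        using V(1) sep by auto
      then have "A = pverts G" using assms(2) AB(1) unfolding G.connected_iff by simp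
      then show False using V AB by auto
    qed
    then have S: "card S \<ge> 1" using fin by (simp add: Suc_le_eq card_gt_0_iff)
    \<comment> \<open>A vertex of \<open>X\<close> has its \<delta> or more neighbours in
      \<open>S\<close> and \<open>X\<close> minus itself; the excluded vertex accounts for the
      +1.\<close>
    have side: "\<delta> + 1 \<le> card S + card X"
      if X: "X \<noteq> {}" "finite X" "X \<subseteq> pverts G"
        and nbr: "\<And>u v. u \<in> X \<Longrightarrow> (u, v) \<in> parcs G \<Longrightarrow> v \<in> S \<union> X" for X
    proof -
      obtain u where u: "u \<in> X" using X(1) by auto
      have "parcs G `` {u} \<subseteq> S \<union> X - {u}" using nbr[OF u] G.no_loops' by auto
      then have "card (parcs G `` {u}) \<le> card (S \<union> X - {u})"
        using fin(1) X(2) by (intro card_mono) auto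
      also have "\<dots> = card (S \<union> X) - 1" using u fin(1) X(2) by simp
      also have "\<dots> \<le> card S + card X - 1" using card_Un_le[of S X] by simp
      finally show ?thesis using deg[of u] u X(3) S by auto
    qed
    have sep': "(u, v) \<notin> parcs G" if "u \<in> B" "v \<in> A" for u v
      using sep[OF that(2,1)] G.parcs_sym by blast
    have a: "\<delta> + 1 \<le> card S + card A"
      using sep G.in_arcsD2 V(1) by (intro side[OF AB(1) fin(2)]) auto
    have b: "\<delta> + 1 \<le> card S + card B"
      using sep' G.in_arcsD2 V(1) by (intro side[OF AB(2) fin(3)]) auto
    have n: "card S + card A + card B = n"
      using V fin assms(3) by (simp add: card_Un_disjoint Int_Un_distrib2)
    have par: "0 < real (card S)" "real (card S) \<le> real k"
      "real (card A) \<ge> real k + 2 - real (card S)" "real (card B) \<ge> real k + 2 - real (card S)"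
      "real (card S) + real (card A) + real (card B) = real k + 2 + real m"
      using S a b n m k(1) S_card by linarith+
    note ext = cut_parameters_extremal[OF par t root[unfolded \<Phi>_def]]
    have t': "t > 0" "t > card A" "t > card B" using t par by linarith+
    \<comment> \<open>Here \<open>ext(1)\<close> gives \<Phi> \<le> 1, and \<rho>(G) \<ge> t - 1
      forces the clique join with \<Phi> = 1. Then \<open>ext(2)\<close> fixes |S| and one side;
      counting vertices gives the other side size \<open>m\<close>.\<close>
    have G: "clique_join G S A B" "card S = k" "card A = 2 \<or> card B = 2"
      using G.spectral_radius_cut_eq[OF V sep \<open>S \<noteq> {}\<close> t' ext(1) assms(2)] ext(2) that(1) rho by auto
    from G(3) show ?thesis
    proof
      assume "card A = 2"
      then show ?thesis
        using digraph_iso_clique_join[OF G(1) G.pair_finite_verts H finH] G(2) n m cardH by simp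
    next
      assume "card B = 2"
      then show ?thesis
        using digraph_iso_clique_join[OF clique_join_swap[OF G(1)]
            G.pair_finite_verts H finH] G(2) n m cardH by simp
    qed
  qed
  ultimately show ?thesis by (auto simp: Let_def)
qed

end
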